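(* Let $G$ be a pendant-free graph with average degree $\bar d(G)\geq 5$, and let $n=|V(\mathcal{L}(G))|=|E(G)|$. Then $$\gamma^{\mathrm{ID}}(\mathcal{L}(G))\leq n-\frac{n}{\Delta(\mathcal{L}(G))}.$$
   Context: Graphs are finite and simple, with nonempty edge set. The average degree is $\bar d(G)=2|E(G)|/|V(G)|$, and $\Delta(\cdot)$ is the maximum degree. The line graph $\mathcal{L}(G)$ has vertex set $E(G)$, two vertices being adjacent if the corresponding edges share an endpoint in $G$. A pair of adjacent edges $ux,uy$ ($x\neq y$) of $G$ is pendant if either both $x$ and $y$ have degree $1$ in $G$, or both $x$ and $y$ have degree $2$ in $G$ and $xy\in E(G)$; $G$ is pendant-free if it has no pendant pair of edges (equivalently, $\mathcal{L}(G)$ has no two distinct vertices with the same closed neighbourhood). An identifying code of a graph $H$ is a set $\mathcal{C}\subseteq V(H)$ such that $N[v]\cap\mathcal{C}\neq\emptyset$ for every vertex $v$ and $N[u]\cap\mathcal{C}\neq N[v]\cap\mathcal{C}$ for all distinct vertices $u,v$, where $N[v]$ is the closed neighbourhood of $v$ in $H$. $\gamma^{\mathrm{ID}}(H)$ is the minimum size of an identifying code of $H$. *)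

theory Defs
  imports Complex_Main
begin

text \<open>An undirected graph is a pair of a vertex set and a set of edges, an edge between
  u and v being the two-element set {u, v}.\<close>

type_synonym 'a ugraph = "'a set \<times> 'a set set"

abbreviation verts :: "'a ugraph \<Rightarrow> 'a set" where
  "verts G \<equiv> fst G"

abbreviation edges :: "'a ugraph \<Rightarrow> 'a set set" where
  "edges G \<equiv> snd G"

definition finite_simple_graph :: "'a ugraph \<Rightarrow> bool" where
  "finite_simple_graph G \<longleftrightarrow>
     finite (verts G) \<and> (\<forall>e \<in> edges G. e \<subseteq> verts G \<and> card e = 2)"

definition nbhd :: "'a ugraph \<Rightarrow> 'a \<Rightarrow> 'a set" where
  "nbhd G v = {w. {v, w} \<in> edges G}"

definition closed_nbhd :: "'a ugraph \<Rightarrow> 'a \<Rightarrow> 'a set" where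
  "closed_nbhd G v = insert v (nbhd G v)"

definition degree :: "'a ugraph \<Rightarrow> 'a \<Rightarrow> nat" where
  "degree G v = card (nbhd G v)"

definition max_degree :: "'a ugraph \<Rightarrow> nat" where
  "max_degree G = Max (degree G ` verts G)"

definition avg_degree :: "'a ugraph \<Rightarrow> real" where
  "avg_degree G = 2 * real (card (edges G)) / real (card (verts G))"

definition line_graph :: "'a ugraph \<Rightarrow> 'a set ugraph" where
  "line_graph G =
     (edges G, {{e, f} |e f. e \<in> edges G \<and> f \<in> edges G \<and> e \<noteq> f \<and> e \<inter> f \<noteq> {}})"

definition pendant_pair :: "'a ugraph \<Rightarrow> 'a set \<Rightarrow> 'a set \<Rightarrow> bool" where
  "pendant_pair G e f \<longleftrightarrow> e \<in> edges G \<and> f \<in> edges G \<and>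
     (\<exists>u x y. e = {u, x} \<and> f = {u, y} \<and> x \<noteq> y \<and>
        (degree G x = 1 \<and> degree G y = 1 \<or>
         degree G x = 2 \<and> degree G y = 2 \<and> {x, y} \<in> edges G))"

definition pendant_free :: "'a ugraph \<Rightarrow> bool" where
  "pendant_free G \<longleftrightarrow> (\<nexists>e f. pendant_pair G e f)"

definition identifying_code :: "'a ugraph \<Rightarrow> 'a set \<Rightarrow> bool" where
  "identifying_code H C \<longleftrightarrow> C \<subseteq> verts H \<and>
     (\<forall>v \<in> verts H. closed_nbhd H v \<inter> C \<noteq> {}) \<and>
     (\<forall>u \<in> verts H. \<forall>v \<in> verts H. u \<noteq> v \<longrightarrow>
        closed_nbhd H u \<inter> C \<noteq> closed_nbhd H v \<inter> C)"

text \<open>This is meaningful only if H has an identifying code at all; for line graphs of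
  pendant-free graphs this is lemma \<open>identifying_code_line_graph_exists\<close> below.\<close>

definition id_code_number :: "'a ugraph \<Rightarrow> nat" where
  "id_code_number H = (LEAST k. \<exists>C. identifying_code H C \<and> card C = k)"

lemma nbhd_line_graph:
  "e \<in> edges G \<Longrightarrow> nbhd (line_graph G) e = {f \<in> edges G. e \<noteq> f \<and> e \<inter> f \<noteq> {}}"
  by (auto simp: nbhd_def line_graph_def doubleton_eq_iff)

lemma closed_nbhd_line_graph:
  assumes "finite_simple_graph G" "e \<in> edges G"
  shows "closed_nbhd (line_graph G) e = {f \<in> edges G. e \<inter> f \<noteq> {}}"
proof -
  have "e \<noteq> {}" using assms by (auto simp: finite_simple_graph_def)
  then show ?thesis using assms(2) by (auto simp: closed_nbhd_def nbhd_line_graph)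
qed

lemma pendant_pair_if_closed_nbhd_eq:
  assumes G: "finite_simple_graph G" and e: "e \<in> edges G" and f: "f \<in> edges G" and "e \<noteq> f"
    and eq: "closed_nbhd (line_graph G) e = closed_nbhd (line_graph G) f"
  shows "pendant_pair G e f"
proof -
  have meet: "e \<inter> g \<noteq> {} \<longleftrightarrow> f \<inter> g \<noteq> {}" if "g \<in> edges G" for g
  proof -
    have "g \<in> closed_nbhd (line_graph G) e \<longleftrightarrow> g \<in> closed_nbhd (line_graph G) f"
      by (simp only: eq)
    then show ?thesis
      unfolding closed_nbhd_line_graph[OF G e] closed_nbhd_line_graph[OF G f] using that by simp
  qed
  have two: "card g = 2" if "g \<in> edges G" for g
    using G that by (auto simp: finite_simple_graph_def)
  have "f \<noteq> {}" using two[OF f] by auto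
  then obtain u where u: "u \<in> e" "u \<in> f" using meet[OF f] by auto
  obtain x where x: "e = {u, x}" "x \<noteq> u"
    using two[OF e] u(1) by (auto simp: card_2_iff)
  obtain y where y: "f = {u, y}" "y \<noteq> u"
    using two[OF f] u(2) by (auto simp: card_2_iff)
  have xy: "x \<noteq> y" using \<open>e \<noteq> f\<close> x y by auto
  have N: "nbhd G a = (if {a, b} \<in> edges G then {u, b} else {u})"
    if ab: "a = x \<and> b = y \<or> a = y \<and> b = x" for a b
  proof -
    have ua: "{u, a} \<in> edges G" using ab e f x(1) y(1) by metis
    have "z = u \<or> z = b" if z: "{a, z} \<in> edges G" for z
    proof -
      have "u \<in> {a, z} \<or> b \<in> {a, z}"
        using meet[OF z] ab unfolding x(1) y(1) by blast
      then show ?thesis using ab x(2) y(2) xy by blast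
    qed
    moreover have "{a, u} \<in> edges G" using ua by (simp add: insert_commute)
    ultimately show ?thesis unfolding nbhd_def by auto
  qed
  have Nx: "nbhd G x = (if {x, y} \<in> edges G then {u, y} else {u})"
    using N[of x y] by blast
  have Ny: "nbhd G y = (if {x, y} \<in> edges G then {u, x} else {u})"
    using N[of y x] unfolding insert_commute[of y x "{}"] by blast
  have "degree G x = 1 \<and> degree G y = 1 \<or>
        degree G x = 2 \<and> degree G y = 2 \<and> {x, y} \<in> edges G"
    using Nx Ny x y by (auto simp: degree_def)
  then show ?thesis unfolding pendant_pair_def using e f x(1) y(1) xy by blast
qed

lemma identifying_code_line_graph_exists:
  assumes "finite_simple_graph G" and "pendant_free G"
  shows "identifying_code (line_graph G) (edges G)"
proof -
  have sub: "closed_nbhd (line_graph G) e \<inter> edges G = closed_nbhd (line_graph G) e"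
    if "e \<in> edges G" for e
    using closed_nbhd_line_graph[OF assms(1) that] by auto
  have V: "verts (line_graph G) = edges G" by (simp add: line_graph_def)
  have ne: "closed_nbhd (line_graph G) e \<noteq> {}" for e by (simp add: closed_nbhd_def)
  show ?thesis unfolding identifying_code_def V
    using sub ne pendant_pair_if_closed_nbhd_eq[OF assms(1)] assms(2)
    unfolding pendant_free_def by (metis order_refl)
qed

end

theory Submission
  imports Defs
begin

text \<open>
  The bound compares three quantities. Let \<open>V\<close> be the vertex set of \<open>G\<close>, let \<open>n\<close> be the number of
  its edges and let \<open>\<Delta>\<close> be the maximum degree of the line graph. The hypothesis on the average degree
  says \<open>n \<ge> 5 |V| / 2\<close>. If moreover \<open>\<Delta> \<ge> 5\<close> and some identifying code has at most \<open>2 |V|\<close>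
  elements, then \<open>n - n / \<Delta> \<ge> (4/5) n \<ge> 2 |V|\<close> and the theorem follows.

  That \<open>\<Delta> \<ge> 5\<close> (\<open>max_degree_line_graph_ge_five\<close>): some vertex \<open>v\<close> has degree at least 5, and as two
  leaves at \<open>v\<close> would form a pendant pair, some neighbour \<open>x\<close> of \<open>v\<close> has another neighbour. The edge
  \<open>{v, x}\<close> then meets at least four other edges in \<open>v\<close> and at least one in \<open>x\<close>.

  That a small code exists (\<open>card_minimal_code_le\<close>): regard an inclusion-minimal code \<open>C\<close> as a
  subgraph of \<open>G\<close>. It is 2-degenerate, that is, each of its subgraphs has a vertex of degree at most
  2, and a 2-degenerate graph has at most twice as many edges as vertices. Degeneracy comes from
  \<open>minimal_code_low_degree_end\<close>: if both ends of \<open>e \<in> C\<close> have degree at least 3 in \<open>C\<close>, then the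
  failure of \<open>C - {e}\<close> to be a code forces one end of \<open>e\<close> to have degree exactly 3 in \<open>C\<close> and a
  neighbour of degree at most 2. Such an edge lies in no subgraph of \<open>C\<close> of minimum degree at
  least 3, because all three edges at that end, and hence also the neighbour of degree at most 2,
  would have to belong to the subgraph.
\<close>

section \<open>Edges at a vertex and codes of line graphs\<close>

definition incident :: "'a set set \<Rightarrow> 'a \<Rightarrow> 'a set set" where
  "incident C v = {e \<in> C. v \<in> e}"

lemma finite_edges:
  assumes "finite_simple_graph G"
  shows "finite (edges G)"
proof (rule finite_subset)
  show "edges G \<subseteq> Pow (verts G)" "finite (Pow (verts G))"
    using assms by (auto simp: finite_simple_graph_def)
qed

lemma edge_at_vertexE:
  assumes "finite_simple_graph G" "e \<in> edges G" "v \<in> e"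
  obtains w where "e = {v, w}" "w \<noteq> v"
proof -
  have "card e = 2" using assms by (auto simp: finite_simple_graph_def)
  then obtain a b where "e = {a, b}" "a \<noteq> b" by (auto simp: card_2_iff)
  then show thesis using assms(3) that[of a] that[of b] by auto
qed

lemma degree_eq_card_incident:
  assumes "finite_simple_graph G"
  shows "degree G v = card (incident (edges G) v)"
proof -
  have "bij_betw (\<lambda>w. {v, w}) (nbhd G v) (incident (edges G) v)"
    unfolding bij_betw_def
  proof
    show "inj_on (\<lambda>w. {v, w}) (nbhd G v)" by (auto simp: inj_on_def doubleton_eq_iff)
    have "e \<in> (\<lambda>w. {v, w}) ` nbhd G v" if "e \<in> edges G" "v \<in> e" for e
    proof -
      obtain w where "e = {v, w}" using edge_at_vertexE[OF assms \<open>e \<in> edges G\<close> \<open>v \<in> e\<close>] .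
      then show ?thesis using \<open>e \<in> edges G\<close> by (auto simp: nbhd_def)
    qed
    then show "(\<lambda>w. {v, w}) ` nbhd G v = incident (edges G) v"
      by (auto simp: nbhd_def incident_def)
  qed
  then show ?thesis unfolding degree_def by (rule bij_betw_same_card)
qed

lemma identifying_code_line_graph_iff:
  assumes "finite_simple_graph G"
  shows "identifying_code (line_graph G) C \<longleftrightarrow>
    C \<subseteq> edges G \<and> (\<forall>f \<in> edges G. \<exists>h \<in> C. h \<inter> f \<noteq> {}) \<and>
    (\<forall>f \<in> edges G. \<forall>g \<in> edges G. f \<noteq> g \<longrightarrow>
      (\<exists>h \<in> C. (h \<inter> f \<noteq> {}) \<noteq> (h \<inter> g \<noteq> {})))"
    (is "_ \<longleftrightarrow> ?sub \<and> ?dom \<and> ?sep")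
proof (cases ?sub)
  case True
  have N: "closed_nbhd (line_graph G) f \<inter> C = {h \<in> C. h \<inter> f \<noteq> {}}" if "f \<in> edges G" for f
    using closed_nbhd_line_graph[OF assms that] True by auto
  have V: "verts (line_graph G) = edges G" by (simp add: line_graph_def)
  have "(\<forall>f \<in> edges G. closed_nbhd (line_graph G) f \<inter> C \<noteq> {}) \<longleftrightarrow> ?dom"
    using N by (simp add: Bex_def)
  moreover have "closed_nbhd (line_graph G) f \<inter> C \<noteq> closed_nbhd (line_graph G) g \<inter> C \<longleftrightarrow>
      (\<exists>h \<in> C. (h \<inter> f \<noteq> {}) \<noteq> (h \<inter> g \<noteq> {}))" if "f \<in> edges G" "g \<in> edges G" for f g
    unfolding N[OF that(1)] N[OF that(2)] by blast
  ultimately show ?thesis unfolding identifying_code_def V using True by simp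
next
  case False
  then show ?thesis by (simp add: identifying_code_def line_graph_def)
qed

section \<open>Minimal codes are 2-degenerate\<close>

text \<open>
  Every edge meeting \<open>e\<close> also meets the other edges of \<open>C\<close> at the common vertex, so \<open>C - {e}\<close> still
  dominates. It must therefore fail to separate two edges \<open>f\<close> and \<open>g\<close>, of which only \<open>f\<close>
  meets \<open>e\<close>, in \<open>w\<close> say. Every other edge of \<open>C\<close> at \<open>w\<close> meets \<open>f\<close>, hence also \<open>g\<close>, so it joins \<open>w\<close> to
  one of the two ends of \<open>g\<close>; as there are at least two such edges, there are exactly two and both
  ends occur. Conversely, every edge of \<open>C\<close> at an end of \<open>g\<close> must meet \<open>f\<close>, and this leaves only two
  possibilities at an end of \<open>g\<close> off \<open>f\<close>. One exists, since \<open>w\<close> is not in \<open>g\<close>. The case \<open>f = e\<close> is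
  included.
\<close>

lemma minimal_code_low_degree_end:
  assumes G: "finite_simple_graph G"
    and C: "identifying_code (line_graph G) C"
    and e: "e \<in> C" and min: "\<not> identifying_code (line_graph G) (C - {e})"
    and deg: "\<And>w. w \<in> e \<Longrightarrow> 3 \<le> card (incident C w)"
  obtains w z where "w \<in> e" "card (incident C w) = 3" "{w, z} \<in> C" "card (incident C z) \<le> 2"
proof -
  note code = identifying_code_line_graph_iff[OF G]
  have sub: "C \<subseteq> edges G"
    and dom: "\<And>f. f \<in> edges G \<Longrightarrow> \<exists>h \<in> C. h \<inter> f \<noteq> {}"
    and sep: "\<And>f g. f \<in> edges G \<Longrightarrow> g \<in> edges G \<Longrightarrow> f \<noteq> g \<Longrightarrow>
      \<exists>h \<in> C. (h \<inter> f \<noteq> {}) \<noteq> (h \<inter> g \<noteq> {})"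
    using C[unfolded code] by simp_all
  have "\<exists>h \<in> C - {e}. h \<inter> f \<noteq> {}" if f: "f \<in> edges G" for f
  proof -
    obtain h where h: "h \<in> C" "h \<inter> f \<noteq> {}" using dom[OF f] by blast
    show ?thesis
    proof (cases "h = e")
      case True
      then obtain w where w: "w \<in> e" "w \<in> f" using h(2) by blast
      have "\<not> incident C w \<subseteq> {e}"
        using deg[OF w(1)] card_mono[of "{e}" "incident C w"] by auto
      then show ?thesis using w(2) by (auto simp: incident_def)
    qed (use h in blast)
  qed
  then have dom': "\<forall>f \<in> edges G. \<exists>h \<in> C - {e}. h \<inter> f \<noteq> {}" by (rule ballI)
  have sub': "C - {e} \<subseteq> edges G" using sub by blast
  have "\<not> (\<forall>f \<in> edges G. \<forall>g \<in> edges G. f \<noteq> g \<longrightarrow>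
      (\<exists>h \<in> C - {e}. (h \<inter> f \<noteq> {}) \<noteq> (h \<inter> g \<noteq> {})))"
  proof
    assume "\<forall>f \<in> edges G. \<forall>g \<in> edges G. f \<noteq> g \<longrightarrow>
      (\<exists>h \<in> C - {e}. (h \<inter> f \<noteq> {}) \<noteq> (h \<inter> g \<noteq> {}))"
    with sub' dom' have "identifying_code (line_graph G) (C - {e})"
      unfolding code by (intro conjI)
    with min show False by contradiction
  qed
  then have "\<exists>f \<in> edges G. \<exists>g \<in> edges G. f \<noteq> g \<and>
      (\<forall>h \<in> C - {e}. (h \<inter> f \<noteq> {}) = (h \<inter> g \<noteq> {}))"
    by (simp only: ball_simps bex_simps not_imp not_not simp_thms)
  then obtain f' g' where fg': "f' \<in> edges G" "g' \<in> edges G" "f' \<noteq> g'"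
    and eq': "\<forall>h \<in> C - {e}. (h \<inter> f' \<noteq> {}) = (h \<inter> g' \<noteq> {})"
    by (elim bexE conjE) (rule that)
  have e_sep: "(e \<inter> f' \<noteq> {}) \<noteq> (e \<inter> g' \<noteq> {})"
  proof -
    obtain h where "h \<in> C" "(h \<inter> f' \<noteq> {}) \<noteq> (h \<inter> g' \<noteq> {})"
      using sep[OF fg'] by (elim bexE) (rule that)
    then show ?thesis using eq' by (cases "h = e") auto
  qed
  obtain f g where f: "f \<in> edges G" and g: "g \<in> edges G"
    and ef: "e \<inter> f \<noteq> {}" and eg: "e \<inter> g = {}"
    and eq: "\<And>h. h \<in> C - {e} \<Longrightarrow> h \<inter> f \<noteq> {} \<longleftrightarrow> h \<inter> g \<noteq> {}"
  proof (cases "e \<inter> f' = {}")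
    case True
    with e_sep have "e \<inter> g' \<noteq> {}" by simp
    then show thesis using eq' by (intro that[OF fg'(2,1) _ True]) auto
  next
    case False
    with e_sep have "e \<inter> g' = {}" by simp
    then show thesis using eq' by (intro that[OF fg'(1,2) False]) auto
  qed
  obtain w where w: "w \<in> e" "w \<in> f" using ef by blast
  obtain x where x: "f = {w, x}" using edge_at_vertexE[OF G f w(2)] by blast
  obtain y where y: "y \<in> g" "y \<noteq> x"
  proof -
    have "card g = 2" using G g by (auto simp: finite_simple_graph_def)
    then have "\<not> g \<subseteq> {x}" using card_mono[of "{x}" g] by auto
    then show thesis using that by blast
  qed
  obtain z where z: "g = {y, z}" using edge_at_vertexE[OF G g y(1)] by blast
  have wsub: "incident C w \<subseteq> {e, {w, y}, {w, z}}"
  proof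
    fix h assume h: "h \<in> incident C w"
    then have hC: "h \<in> C" "w \<in> h" by (auto simp: incident_def)
    show "h \<in> {e, {w, y}, {w, z}}"
    proof (cases "h = e")
      case False
      then have "h \<inter> g \<noteq> {}" using eq[of h] hC w(2) by blast
      moreover obtain t where "h = {w, t}"
        using edge_at_vertexE[OF G _ hC(2)] hC(1) sub by blast
      moreover have "w \<notin> g" using w(1) eg by blast
      ultimately show ?thesis using z by auto
    qed simp
  qed
  have three: "card (incident C w) = 3" and full: "incident C w = {e, {w, y}, {w, z}}"
  proof -
    have le: "card {e, {w, y}, {w, z}} \<le> 3" by (simp add: card_insert_if)
    then show "card (incident C w) = 3"
      using card_mono[OF _ wsub] deg[OF w(1)] by simp
    show "incident C w = {e, {w, y}, {w, z}}"
      using card_seteq[OF _ wsub] le deg[OF w(1)] by simp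
  qed
  have "incident C y \<subseteq> {{y, w}, {y, x}}"
  proof
    fix h assume h: "h \<in> incident C y"
    then have hC: "h \<in> C" "y \<in> h" by (auto simp: incident_def)
    have "h \<noteq> e" using hC(2) y(1) eg by blast
    then have "h \<inter> f \<noteq> {}" using eq[of h] hC y(1) by blast
    moreover obtain t where "h = {y, t}"
      using edge_at_vertexE[OF G _ hC(2)] hC(1) sub by blast
    moreover have "y \<noteq> w" using w(1) y(1) eg by blast
    ultimately show "h \<in> {{y, w}, {y, x}}" using x y(2) by auto
  qed
  then have "card (incident C y) \<le> card {{y, w}, {y, x}}" by (intro card_mono) auto
  also have "\<dots> \<le> 2" by (simp add: card_insert_if)
  finally have "card (incident C y) \<le> 2" .
  moreover have "{w, y} \<in> C" using full by (auto simp: incident_def)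
  ultimately show thesis using that w(1) three by blast
qed

text \<open>The edge bound for 2-degenerate graphs: deleting a vertex of degree at most 2 loses at most
  two edges. Non-empty edges are required because an empty one would survive the deletion of
  all vertices.\<close>

lemma card_edges_le_if_two_degenerate:
  assumes "finite V" "finite C" "{} \<notin> C"
    and low: "\<And>S. S \<subseteq> V \<Longrightarrow> S \<noteq> {} \<Longrightarrow> \<exists>v \<in> S. card (incident {e \<in> C. e \<subseteq> S} v) \<le> 2"
  shows "card {e \<in> C. e \<subseteq> V} \<le> 2 * card V"
  using assms(1) low
proof (induction "card V" arbitrary: V)
  case 0
  then have "V = {}" by simp
  then have "{e \<in> C. e \<subseteq> V} = {}" using assms(3) by auto
  then show ?case by (metis card.empty le0)
next
  case (Suc k)
  have "V \<noteq> {}" using Suc.hyps(2) by auto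
  then obtain v where v: "v \<in> V" "card (incident {e \<in> C. e \<subseteq> V} v) \<le> 2"
    using Suc.prems(2)[of V] by blast
  have k: "k = card (V - {v})" using Suc.hyps(2) v(1) Suc.prems(1) by simp
  have IH: "card {e \<in> C. e \<subseteq> V - {v}} \<le> 2 * card (V - {v})"
    using Suc.hyps(1)[OF k] Suc.prems by blast
  have split: "{e \<in> C. e \<subseteq> V} = {e \<in> C. e \<subseteq> V - {v}} \<union> incident {e \<in> C. e \<subseteq> V} v"
    by (auto simp: incident_def)
  have "card {e \<in> C. e \<subseteq> V} \<le> card {e \<in> C. e \<subseteq> V - {v}} + card (incident {e \<in> C. e \<subseteq> V} v)"
    by (subst split) (rule card_Un_le)
  then show ?case using IH v(2) k Suc.hyps(2) by linarith
qed

lemma card_minimal_code_le: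
  assumes G: "finite_simple_graph G"
    and C: "identifying_code (line_graph G) C"
    and min: "\<And>e. e \<in> C \<Longrightarrow> \<not> identifying_code (line_graph G) (C - {e})"
  shows "card C \<le> 2 * card (verts G)"
proof -
  have sub: "C \<subseteq> edges G" using C by (simp add: identifying_code_line_graph_iff[OF G])
  have finC: "finite C" using sub finite_edges[OF G] by (rule finite_subset)
  have low: "\<exists>v \<in> S. card (incident {e \<in> C. e \<subseteq> S} v) \<le> 2" if "S \<noteq> {}" for S
  proof (rule ccontr)
    assume "\<not> ?thesis"
    then have high: "3 \<le> card (incident {e \<in> C. e \<subseteq> S} v)" if "v \<in> S" for v
      using that by force
    have inc_sub: "incident {e \<in> C. e \<subseteq> S} v \<subseteq> incident C v" and fin: "finite (incident C v)" for v
      using finC by (auto simp: incident_def)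
    have highC: "3 \<le> card (incident C v)" if "v \<in> S" for v
      using high[OF that] card_mono[OF fin inc_sub] le_trans by blast
    obtain v where "v \<in> S" using \<open>S \<noteq> {}\<close> by blast
    then have "incident {e \<in> C. e \<subseteq> S} v \<noteq> {}" using high by fastforce
    then obtain e where e: "e \<in> C" "e \<subseteq> S" by (auto simp: incident_def)
    obtain w z where w: "w \<in> e" "card (incident C w) = 3"
      and z: "{w, z} \<in> C" "card (incident C z) \<le> 2"
      using minimal_code_low_degree_end[OF G C e(1) min[OF e(1)]] highC e(2) by blast
    \<comment> \<open>\<open>w\<close> has only three edges in \<open>C\<close>, so all of them stay inside \<open>S\<close>, including the one to \<open>z\<close>.\<close>
    have "incident {e \<in> C. e \<subseteq> S} w = incident C w"
    proof (rule card_seteq[OF fin inc_sub])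
      have "w \<in> S" using w(1) e(2) by blast
      then show "card (incident C w) \<le> card (incident {e \<in> C. e \<subseteq> S} w)"
        using high w(2) by simp
    qed
    moreover have "{w, z} \<in> incident C w" using z(1) by (simp add: incident_def)
    ultimately have "{w, z} \<in> incident {e \<in> C. e \<subseteq> S} w" by simp
    then have "z \<in> S" by (simp add: incident_def)
    then show False using highC[of z] z(2) by simp
  qed
  have "{} \<notin> edges G" using G unfolding finite_simple_graph_def by fastforce
  then have "{} \<notin> C" using sub by blast
  moreover have "finite (verts G)" using G by (simp add: finite_simple_graph_def)
  ultimately have "card {e \<in> C. e \<subseteq> verts G} \<le> 2 * card (verts G)"
    using finC low by (intro card_edges_le_if_two_degenerate)
  moreover have "{e \<in> C. e \<subseteq> verts G} = C" using sub G by (auto simp: finite_simple_graph_def)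
  ultimately show ?thesis by simp
qed

lemma id_code_number_line_graph_le:
  assumes G: "finite_simple_graph G" and "pendant_free G"
  shows "id_code_number (line_graph G) \<le> 2 * card (verts G)"
proof -
  let ?P = "\<lambda>k. \<exists>C. identifying_code (line_graph G) C \<and> card C = k"
  have "?P (card (edges G))" using identifying_code_line_graph_exists[OF assms] by blast
  then have "?P (id_code_number (line_graph G))" unfolding id_code_number_def by (rule LeastI)
  then obtain C where C: "identifying_code (line_graph G) C"
    and card: "card C = id_code_number (line_graph G)" by blast
  have "C \<subseteq> edges G" using C by (simp add: identifying_code_line_graph_iff[OF G])
  then have "finite C" using finite_edges[OF G] by (rule finite_subset)
  have "\<not> identifying_code (line_graph G) (C - {e})" if "e \<in> C" for e
  proof -
    have "card (C - {e}) < (LEAST k. ?P k)"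
      using card_Diff1_less[OF \<open>finite C\<close> that] card by (simp add: id_code_number_def)
    then show ?thesis using not_less_Least by blast
  qed
  then show ?thesis using card_minimal_code_le[OF G C] card by metis
qed

section \<open>Degrees in the graph and in its line graph\<close>

lemma sum_degree_eq:
  assumes G: "finite_simple_graph G"
  shows "(\<Sum>v \<in> verts G. degree G v) = 2 * card (edges G)"
proof -
  have "(\<Sum>v \<in> verts G. card {e \<in> edges G. v \<in> e}) = 2 * card (edges G)"
  proof (rule sum_multicount)
    show "\<forall>e \<in> edges G. card {v \<in> verts G. v \<in> e} = 2"
    proof
      fix e assume "e \<in> edges G"
      then have "{v \<in> verts G. v \<in> e} = e" "card e = 2"
        using G by (auto simp: finite_simple_graph_def)
      then show "card {v \<in> verts G. v \<in> e} = 2" by simp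
    qed
  qed (use G finite_edges[OF G] in \<open>auto simp: finite_simple_graph_def\<close>)
  then show ?thesis by (simp add: degree_eq_card_incident[OF G] incident_def)
qed

lemma exists_degree_ge_avg_degree:
  assumes G: "finite_simple_graph G" and ne: "edges G \<noteq> {}"
  obtains v where "v \<in> verts G" "avg_degree G \<le> real (degree G v)"
proof -
  have fin: "finite (verts G)" using G by (simp add: finite_simple_graph_def)
  have V: "verts G \<noteq> {}" using G ne by (fastforce simp: finite_simple_graph_def)
  have "\<exists>v \<in> verts G. avg_degree G \<le> real (degree G v)"
  proof (rule ccontr)
    assume "\<not> ?thesis"
    then have "(\<Sum>v \<in> verts G. real (degree G v)) < (\<Sum>v \<in> verts G. avg_degree G)"
      using fin V by (intro sum_strict_mono) auto
    also have "\<dots> = 2 * real (card (edges G))"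
      using fin V by (simp add: avg_degree_def)
    also have "\<dots> = (\<Sum>v \<in> verts G. real (degree G v))"
      using arg_cong[OF sum_degree_eq[OF G], of real] by simp
    finally show False by simp
  qed
  then show thesis using that by blast
qed

lemma max_degree_line_graph_ge_five:
  assumes G: "finite_simple_graph G" and pf: "pendant_free G" and v: "5 \<le> degree G v"
  shows "5 \<le> max_degree (line_graph G)"
proof -
  have fin: "finite (edges G)" by (rule finite_edges[OF G])
  have deg1: "1 \<le> degree G x" if "{v, x} \<in> edges G" for x
  proof -
    have "incident (edges G) x \<noteq> {}" using that by (auto simp: incident_def)
    then show ?thesis using fin
      by (simp add: degree_eq_card_incident[OF G] incident_def Suc_le_eq card_gt_0_iff)
  qed
  \<comment> \<open>Of two neighbours of \<open>v\<close>, at most one is a leaf.\<close>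
  obtain x where x: "{v, x} \<in> edges G" "degree G x \<noteq> 1"
  proof -
    have "\<not> nbhd G v \<subseteq> {a}" for a using v card_mono[of "{a}" "nbhd G v"] by (auto simp: degree_def)
    then obtain a b where "a \<in> nbhd G v" "b \<in> nbhd G v" "a \<noteq> b" by blast
    then show thesis
      using pf that[of a] that[of b] unfolding pendant_free_def pendant_pair_def nbhd_def by blast
  qed
  let ?e = "{v, x}"
  \<comment> \<open>\<open>{v, x}\<close> is adjacent to the remaining edges at \<open>v\<close> and to a further edge \<open>h\<close> at \<open>x\<close>.\<close>
  have "card ?e = 2" using G x(1) unfolding finite_simple_graph_def by blast
  then have vx: "v \<noteq> x" by auto
  have two: "2 \<le> card (incident (edges G) x)"
    using deg1[OF x(1)] x(2) by (simp add: degree_eq_card_incident[OF G])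
  have "\<not> incident (edges G) x \<subseteq> {?e}"
    using two card_mono[of "{?e}" "incident (edges G) x"] by auto
  then obtain h where h: "h \<in> edges G" "x \<in> h" "h \<noteq> ?e" by (auto simp: incident_def)
  have "v \<notin> h" using edge_at_vertexE[OF G h(1,2)] h(3) vx by (metis insertE insert_commute singletonD)
  let ?A = "incident (edges G) v - {?e}"
  have finA: "finite ?A" using fin by (simp add: incident_def)
  have "5 \<le> card (incident (edges G) v)" using v degree_eq_card_incident[OF G] by metis
  then have "4 \<le> card ?A" using x(1) by (simp add: incident_def)
  moreover have "h \<notin> ?A" using \<open>v \<notin> h\<close> by (simp add: incident_def)
  ultimately have "5 \<le> card (insert h ?A)" using finA by simp
  also have "insert h ?A \<subseteq> nbhd (line_graph G) ?e"
    unfolding nbhd_line_graph[OF x(1)] using h by (auto simp: incident_def)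
  then have "card (insert h ?A) \<le> degree (line_graph G) ?e"
    unfolding degree_def using fin by (intro card_mono) (auto simp: nbhd_line_graph[OF x(1)])
  also have "\<dots> \<le> max_degree (line_graph G)"
    unfolding max_degree_def using fin x(1) by (intro Max_ge) (auto simp: line_graph_def)
  finally show ?thesis .
qed

section \<open>The bound on the identifying code number\<close>

theorem corollary21:
  fixes G :: "'a ugraph" and n :: nat
  assumes "finite_simple_graph G"
    and "edges G \<noteq> {}"
    and "pendant_free G"
    and "avg_degree G \<ge> 5"
    and "n = card (verts (line_graph G))"
  shows "real (id_code_number (line_graph G))
           \<le> real n - real n / real (max_degree (line_graph G))"
proof -
  let ?\<Delta> = "real (max_degree (line_graph G))"
  have n: "n = card (edges G)" using assms(5) by (simp add: line_graph_def)
  obtain v where "avg_degree G \<le> real (degree G v)"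
    using exists_degree_ge_avg_degree[OF assms(1,2)] by blast
  then have "5 \<le> degree G v" using assms(4) by linarith
  then have \<Delta>: "5 \<le> ?\<Delta>"
    using max_degree_line_graph_ge_five[OF assms(1,3)] by fastforce
  have "0 < card (verts G)"
    using assms(4) unfolding avg_degree_def by (cases "card (verts G) = 0") simp_all
  then have "5 * real (card (verts G)) \<le> 2 * real n"
    using assms(4) by (simp add: avg_degree_def n field_simps)
  moreover have "real (id_code_number (line_graph G)) \<le> 2 * real (card (verts G))"
    using id_code_number_line_graph_le[OF assms(1,3)] by linarith
  moreover have "real n / ?\<Delta> \<le> real n / 5" using \<Delta> by (intro divide_left_mono) auto
  ultimately show ?thesis by linarith
qed

end
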